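(* Let $n\geq 3$ and let $r_1\geq r_2\geq\cdots\geq r_n\geq 1$ be integers. If $\sum_{i=3}^{n} r_i\geq n+1$, then $Par(r_1,\ldots,r_n)\notin\mathfrak{N}$.
   Context: Multigraphs are finite and may have multiple edges but no loops. An interval $t$-coloring of a multigraph $G$ is a proper edge-coloring (edges sharing an endpoint get distinct colors) with colors $1,\ldots,t$ such that every color is used and for every vertex $v$ the set of colors of edges incident to $v$ is an interval of integers. $\mathfrak{N}$ denotes the set of multigraphs having an interval $t$-coloring for some positive integer $t$. The parachute multigraph $Par(r_1,\ldots,r_n)$ has vertex set $\{u,w,v_1,\ldots,v_n\}$, with exactly $r_i$ parallel edges between $u$ and $v_i$ for each $1\leq i\leq n$, and exactly one edge between $v_j$ and $w$ for each $1\leq j\leq n$; there are no other edges. *)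

theory Defs
  imports Main
begin

record ('v, 'e) multigraph =
  verts :: "'v set"
  edges :: "'e set"
  ends :: "'e \<Rightarrow> 'v set"

text \<open>Parallel edges are distinct elements of \<open>edges\<close> with equal \<open>ends\<close>;
  \<open>card (ends G e) = 2\<close> rules out loops.\<close>

definition is_multigraph :: "('v, 'e) multigraph \<Rightarrow> bool" where
  "is_multigraph G \<longleftrightarrow> finite (verts G) \<and> finite (edges G) \<and>
     (\<forall>e\<in>edges G. ends G e \<subseteq> verts G \<and> card (ends G e) = 2)"

definition incident_edges :: "('v, 'e) multigraph \<Rightarrow> 'v \<Rightarrow> 'e set" where
  "incident_edges G v = {e \<in> edges G. v \<in> ends G e}"

definition proper_edge_coloring :: "('v, 'e) multigraph \<Rightarrow> ('e \<Rightarrow> nat) \<Rightarrow> bool" where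
  "proper_edge_coloring G c \<longleftrightarrow>
     (\<forall>e\<in>edges G. \<forall>f\<in>edges G. e \<noteq> f \<and> ends G e \<inter> ends G f \<noteq> {} \<longrightarrow> c e \<noteq> c f)"

definition interval_coloring :: "('v, 'e) multigraph \<Rightarrow> nat \<Rightarrow> ('e \<Rightarrow> nat) \<Rightarrow> bool" where
  "interval_coloring G t c \<longleftrightarrow>
     proper_edge_coloring G c \<and> c ` edges G = {1..t} \<and>
     (\<forall>v\<in>verts G. \<exists>a b. c ` incident_edges G v = {a..b})"

definition interval_colorable :: "('v, 'e) multigraph set" ("\<NN>") where
  "\<NN> = {G. is_multigraph G \<and> (\<exists>t\<ge>1. \<exists>c. interval_coloring G t c)}"

datatype par_vertex = U | W | V nat

text \<open>\<open>UV i k\<close> is the \<open>k\<close>-th of the parallel edges between \<open>u\<close> and \<open>v\<^sub>i\<close>.\<close>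

datatype par_edge = UV nat nat | VW nat

fun par_ends :: "par_edge \<Rightarrow> par_vertex set" where
  "par_ends (UV i k) = {U, V i}"
| "par_ends (VW j) = {V j, W}"

definition Par :: "nat \<Rightarrow> (nat \<Rightarrow> nat) \<Rightarrow> (par_vertex, par_edge) multigraph" where
  "Par n r = \<lparr>verts = {U, W} \<union> V ` {1..n},
     edges = {UV i k | i k. i \<in> {1..n} \<and> k \<in> {1..r i}} \<union> VW ` {1..n},
     ends = par_ends\<rparr>"

lemma is_multigraph_Par: "is_multigraph (Par n r)"
proof -
  have "{UV i k | i k. i \<in> {1..n} \<and> k \<in> {1..r i}} = (\<Union>i\<in>{1..n}. UV i ` {1..r i})"
    by blast
  then have fin: "finite (edges (Par n r))"
    by (simp add: Par_def)
  have "ends (Par n r) e \<subseteq> verts (Par n r) \<and> card (ends (Par n r) e) = 2"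
    if "e \<in> edges (Par n r)" for e
    using that by (cases e) (simp_all add: Par_def image_iff)
  moreover have "finite (verts (Par n r))"
    by (simp add: Par_def)
  ultimately show ?thesis
    using fin by (simp add: is_multigraph_def)
qed

lemma card_edges_u_v:
  assumes "i \<in> {1..n}"
  shows "card {e \<in> edges (Par n r). ends (Par n r) e = {U, V i}} = r i"
proof -
  have "{e \<in> edges (Par n r). ends (Par n r) e = {U, V i}} = UV i ` {1..r i}"
    using assms by (auto simp: Par_def doubleton_eq_iff)
  then show ?thesis
    by (simp add: card_image inj_on_def)
qed

lemma card_edges_v_w:
  assumes "j \<in> {1..n}"
  shows "card {e \<in> edges (Par n r). ends (Par n r) e = {V j, W}} = 1"
proof -
  have "{e \<in> edges (Par n r). ends (Par n r) e = {V j, W}} = {VW j}"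
  proof -
    have "par_ends e = {V j, W} \<longleftrightarrow> e = VW j" for e
      by (cases e) (simp only: par_ends.simps doubleton_eq_iff, blast)+
    then show ?thesis
      using assms by (auto simp: Par_def)
  qed
  then show ?thesis
    by simp
qed

end

theory Submission
  imports Defs
begin

text \<open>The colors at \<open>u\<close> form an interval of length \<open>R = r\<^sub>1 + \<dots> + r\<^sub>n\<close>. Let the smallest of them occur
  at \<open>v\<^sub>i\<close> and the largest at \<open>v\<^sub>j\<close>. Since the colors at \<open>v\<^sub>i\<close> and \<open>v\<^sub>j\<close> form intervals of lengths
  \<open>r\<^sub>i + 1\<close> and \<open>r\<^sub>j + 1\<close>, the colors of \<open>v\<^sub>iw\<close> and \<open>v\<^sub>jw\<close> differ by at least
  \<open>R - 1 - r\<^sub>i - r\<^sub>j \<ge> r\<^sub>3 + \<dots> + r\<^sub>n - 1 \<ge> n\<close> if \<open>i \<noteq> j\<close>, whereas the colors at \<open>w\<close> span only \<open>n - 1\<close>.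
  If \<open>i = j\<close>, the interval at \<open>v\<^sub>i\<close> is too short to contain both extreme colors.\<close>

lemma interval_coloring_inj_on:
  assumes "interval_coloring G t c"
  shows "inj_on c (incident_edges G v)"
proof (rule inj_onI)
  fix e f
  assume "e \<in> incident_edges G v" "f \<in> incident_edges G v" "c e = c f"
  moreover have "proper_edge_coloring G c"
    using assms by (simp add: interval_coloring_def)
  ultimately show "e = f"
    unfolding incident_edges_def proper_edge_coloring_def by blast
qed

text \<open>Properness makes \<open>c\<close> injective at \<open>v\<close>, so the interval of
  colors there has exactly as many elements as \<open>v\<close> has incident edges.\<close>

lemma interval_coloring_spread:
  assumes "interval_coloring G t c" "v \<in> verts G"
    and "e \<in> incident_edges G v" "f \<in> incident_edges G v"
  shows "c e < c f + card (incident_edges G v)"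
proof -
  obtain a b where ab: "c ` incident_edges G v = {a..b}"
    using assms(1,2) unfolding interval_coloring_def by blast
  have "card (incident_edges G v) = Suc b - a"
    using card_image[OF interval_coloring_inj_on[OF assms(1)], of v] ab by simp
  moreover have "c e \<in> {a..b}" "c f \<in> {a..b}"
    using assms(3,4) ab by blast+
  ultimately show ?thesis
    unfolding atLeastAtMost_iff by linarith
qed

text \<open>The two edges carry the endpoints of the color interval at \<open>v\<close>;
  nonemptiness rules out an empty \<open>{a..b}\<close> with \<open>a > b\<close>.\<close>

lemma interval_coloring_extremes:
  assumes "interval_coloring G t c" "v \<in> verts G" "incident_edges G v \<noteq> {}"
  obtains e f where "e \<in> incident_edges G v" "f \<in> incident_edges G v"
    "c f + 1 = c e + card (incident_edges G v)"
proof -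
  obtain a b where ab: "c ` incident_edges G v = {a..b}"
    using assms(1,2) unfolding interval_coloring_def by blast
  have card: "card (incident_edges G v) = Suc b - a"
    using card_image[OF interval_coloring_inj_on[OF assms(1)], of v] ab by simp
  have "a \<le> b"
    using ab assms(3) by (metis atLeastatMost_empty_iff image_is_empty)
  then have "a \<in> c ` incident_edges G v" "b \<in> c ` incident_edges G v"
    using ab by simp_all
  then obtain e f where "e \<in> incident_edges G v" "f \<in> incident_edges G v" "c e = a" "c f = b"
    by blast
  with that card \<open>a \<le> b\<close> show ?thesis
    by simp
qed

lemma incident_edges_Par_U:
  "incident_edges (Par n r) U = (\<lambda>(i, k). UV i k) ` (SIGMA i:{1..n}. {1..r i})"
  by (auto simp: incident_edges_def Par_def image_iff)

lemma card_incident_edges_Par_U: "card (incident_edges (Par n r) U) = (\<Sum>i=1..n. r i)"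
proof -
  have "inj_on (\<lambda>(i, k). UV i k) (SIGMA i:{1..n}. {1..r i})"
    by (auto simp: inj_on_def)
  then show ?thesis
    by (simp add: incident_edges_Par_U card_image)
qed

lemma incident_edges_Par_V:
  assumes "i \<in> {1..n}"
  shows "incident_edges (Par n r) (V i) = insert (VW i) (UV i ` {1..r i})"
  using assms by (auto simp: incident_edges_def Par_def)

lemma card_incident_edges_Par_V:
  assumes "i \<in> {1..n}"
  shows "card (incident_edges (Par n r) (V i)) = r i + 1"
proof -
  have "VW i \<notin> UV i ` {1..r i}" "inj_on (UV i) {1..r i}"
    by (auto simp: inj_on_def)
  then show ?thesis
    by (simp add: incident_edges_Par_V[OF assms] card_image)
qed

lemma incident_edges_Par_W: "incident_edges (Par n r) W = VW ` {1..n}"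
  by (auto simp: incident_edges_def Par_def)

lemma card_incident_edges_Par_W: "card (incident_edges (Par n r) W) = n"
  by (simp add: incident_edges_Par_W card_image inj_on_def)

text \<open>Of two distinct indices the smaller is at least 1 and the larger at least 2, and
  \<open>r\<close> is nonincreasing.\<close>

lemma sum_two_le_first_two:
  fixes r :: "nat \<Rightarrow> nat"
  assumes "\<And>i j. 1 \<le> i \<Longrightarrow> i \<le> j \<Longrightarrow> j \<le> n \<Longrightarrow> r i \<ge> r j"
    and "i \<in> {1..n}" "j \<in> {1..n}" "i \<noteq> j"
  shows "r i + r j \<le> r 1 + r 2"
proof (cases "i < j")
  case True
  then show ?thesis
    using assms(1)[of 1 i] assms(1)[of 2 j] assms(2,3) by simp
next
  case False
  then show ?thesis
    using assms(1)[of 1 j] assms(1)[of 2 i] assms(2-4) by simp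
qed

theorem theorem15:
  fixes n :: nat and r :: "nat \<Rightarrow> nat"
  assumes "n \<ge> 3"
    and "\<And>i j. 1 \<le> i \<Longrightarrow> i \<le> j \<Longrightarrow> j \<le> n \<Longrightarrow> r i \<ge> r j"
    and "r n \<ge> 1"
    and "(\<Sum>i=3..n. r i) \<ge> n + 1"
  shows "Par n r \<notin> \<NN>"
proof
  assume "Par n r \<in> \<NN>"
  then obtain t c where c: "interval_coloring (Par n r) t c"
    by (auto simp: interval_colorable_def)
  define R where "R = (\<Sum>i=1..n. r i)"
  have R: "R = r 1 + r 2 + (\<Sum>i=3..n. r i)"
    using assms(1) by (simp add: R_def sum.atLeast_Suc_atMost numeral_eq_Suc)
  then have "R > 0"
    using assms(4) by simp
  then have "incident_edges (Par n r) U \<noteq> {}"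
    using card_incident_edges_Par_U[of n r] by (auto simp: R_def)
  then obtain e f where ef: "e \<in> incident_edges (Par n r) U" "f \<in> incident_edges (Par n r) U"
    "c f + 1 = c e + R"
    using interval_coloring_extremes[OF c, of U] card_incident_edges_Par_U[of n r]
    by (auto simp: R_def Par_def)
  obtain i k where i: "e = UV i k" "i \<in> {1..n}" "k \<in> {1..r i}"
    using ef(1) by (auto simp: incident_edges_Par_U)
  obtain j l where j: "f = UV j l" "j \<in> {1..n}" "l \<in> {1..r j}"
    using ef(2) by (auto simp: incident_edges_Par_U)
  have spread_V: "c x < c y + (r m + 1)"
    if "m \<in> {1..n}" "x \<in> insert (VW m) (UV m ` {1..r m})" "y \<in> insert (VW m) (UV m ` {1..r m})"
    for m x y
  proof -
    have "V m \<in> verts (Par n r)"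
      using that(1) by (simp add: Par_def)
    from interval_coloring_spread[OF c this, unfolded card_incident_edges_Par_V[OF that(1)]]
    show ?thesis
      using that by (simp add: incident_edges_Par_V)
  qed
  show False
  proof (cases "i = j")
    case True
    \<comment> \<open>Here \<open>R - 1 \<le> r i \<le> r 1\<close>, while the sum hypothesis gives
      \<open>R - 1 \<ge> r 1 + r 2 + n\<close>.\<close>
    have "c f < c e + (r i + 1)"
      using spread_V[of i f e] i j True by blast
    moreover have "r i \<le> r 1"
      using assms(2)[of 1 i] i by simp
    ultimately show False
      using ef(3) R assms(1,4) by linarith
  next
    case False
    \<comment> \<open>Along the path \<open>e\<close>, \<open>VW i\<close>, \<open>VW j\<close>,
      \<open>f\<close> the color rises by at most \<open>r i\<close>, \<open>n - 1\<close> and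
      \<open>r j\<close> in turn, so \<open>R - 1 \<le> r 1 + r 2 + n - 1\<close>, one less than the
      sum hypothesis forces.\<close>
    have "c (VW i) < c e + (r i + 1)"
      using spread_V[of i "VW i" e] i by blast
    moreover have "c f < c (VW j) + (r j + 1)"
      using spread_V[of j f "VW j"] j by blast
    moreover have "c (VW j) < c (VW i) + n"
    proof -
      have "W \<in> verts (Par n r)"
        by (simp add: Par_def)
      from interval_coloring_spread[OF c this, unfolded card_incident_edges_Par_W]
      show ?thesis
        using i(2) j(2) by (simp add: incident_edges_Par_W)
    qed
    moreover have "r i + r j \<le> r 1 + r 2"
      using sum_two_le_first_two[OF assms(2) i(2) j(2) False] by simp
    ultimately show False
      using ef(3) R assms(4) by linarith
  qed
qed

end
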